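(* Let $k\geq 1$, $m>n\geq 0$ and $1\leq d\leq m$ be integers. Then $$E_{2^km}^{(2^k)}(q)\equiv q^{2^{k-1}(m-n)}E_{2^kn}^{(2^k)}(q)\pmod{1+q^{2^{k-1}d}}\quad\text{if and only if}\quad m\equiv n\pmod d.$$
   Context: For $n\ge 1$ let $(a;q)_n=(1-a)(1-aq)\cdots(1-aq^{n-1})$, and $(a;q)_0=1$. For an integer $K\ge 1$, the generalized $q$-Euler numbers $E_{Kn}^{(K)}(q)$ ($n\ge 0$) are defined by the formal power series identity $$\sum_{n=0}^{\infty}E_{Kn}^{(K)}(q)\frac{x^{Kn}}{(q;q)_{Kn}}=\left(\sum_{n=0}^{\infty}\frac{x^{Kn}}{(q;q)_{Kn}}\right)^{-1}.$$ They are polynomials in $q$ with integer coefficients. Here they are used with $K=2^k$. Congruences between polynomials modulo a polynomial are understood in $\mathbb{Z}[q]$: $A(q)\equiv B(q)\pmod{C(q)}$ means that $C(q)$ divides $A(q)-B(q)$ in $\mathbb{Z}[q]$. *)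

theory Defs
  imports "HOL-Computational_Algebra.Computational_Algebra" "HOL-Number_Theory.Cong"
begin

definition qpoch :: "'a::comm_ring_1 \<Rightarrow> 'a \<Rightarrow> nat \<Rightarrow> 'a" where
  "qpoch a q n = (\<Prod>i<n. 1 - a * q ^ i)"

(* The indeterminate q of \<int>[q], as an element of the fraction field \<rat>(q). *)
definition q_var :: "int poly fract" where
  "q_var = to_fract (monom 1 1)"

(* The series in x with the term x^(K n) / (q;q)_(K n) for each n; this reading
   of the divisibility condition uses K \<ge> 1. *)
definition q_exp_series :: "nat \<Rightarrow> int poly fract fps" where
  "q_exp_series K =
     Abs_fps (\<lambda>j. if K dvd j then 1 / qpoch q_var q_var j else 0)"

(* q_euler K j has the full index j as its subscript, so E_{Kn}^{(K)}(q) is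
   q_euler K (K * n). It is defined as (q;q)_j times the coefficient of x^j in the
   reciprocal series; to_fract_q_euler below shows that this is in \<int>[q]. *)
definition q_euler :: "nat \<Rightarrow> nat \<Rightarrow> int poly" where
  "q_euler K j =
     (THE p. to_fract p = qpoch q_var q_var j * fps_nth (inverse (q_exp_series K)) j)"

lemma qpoch_0 [simp]: "qpoch a q 0 = 1"
  by (simp add: qpoch_def)

lemma qpoch_Suc: "qpoch a q (Suc n) = qpoch a q n * (1 - a * q ^ n)"
  by (simp add: qpoch_def)

lemma q_var_power: "q_var ^ n = to_fract (monom 1 n)"
proof (induction n)
  case (Suc n)
  have "q_var ^ Suc n = to_fract (monom 1 1 * monom 1 n)"
    using Suc by (simp only: q_var_def power_Suc to_fract_mult)
  then show ?case by (simp add: mult_monom)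
qed (simp flip: one_pCons add: monom_0)

lemma q_var_power_neq_1: "q_var * q_var ^ n \<noteq> 1"
proof
  assume "q_var * q_var ^ n = 1"
  then have "to_fract (monom 1 (Suc n)) = to_fract (1 :: int poly)"
    by (simp only: q_var_power [symmetric]) simp
  then have "monom 1 (Suc n) = (1 :: int poly)" by (simp only: to_fract_eq_iff)
  then have "degree (monom (1 :: int) (Suc n)) = degree (1 :: int poly)" by simp
  then show False by (simp add: degree_monom_eq)
qed

lemma qpoch_q_var_neq_0: "qpoch q_var q_var n \<noteq> 0"
  by (simp add: qpoch_def q_var_power_neq_1)

lemma q_binomial_integral:
  "qpoch q_var q_var (i + j) / (qpoch q_var q_var i * qpoch q_var q_var j) \<in> range to_fract"
proof (induction "i + j" arbitrary: i j)
  case 0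
  have "to_fract (1 :: int poly) \<in> range to_fract" by blast
  with 0 show ?case by simp
next
  case (Suc n)
  have 1: "1 \<in> range (to_fract :: int poly \<Rightarrow> _)"
    by (metis rangeI to_fract_1)
  show ?case
  proof (cases "i = 0 \<or> j = 0")
    case True
    then show ?thesis using 1 by (auto simp: qpoch_q_var_neq_0)
  next
    case False
    then obtain a b where ab: "i = Suc a" "j = Suc b" by (metis not0_implies_Suc)
    let ?P = "qpoch q_var q_var"
    let ?B = "\<lambda>i j. ?P (i + j) / (?P i * ?P j)"
    obtain u where u: "?B a (Suc b) = to_fract u"
      using Suc.hyps(1)[of a "Suc b"] Suc.hyps(2) ab by auto
    obtain v where v: "?B (Suc a) b = to_fract v"
      using Suc.hyps(1)[of "Suc a" b] Suc.hyps(2) ab by auto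
    define A B C where "A = 1 - q_var * q_var ^ a" and "B = 1 - q_var * q_var ^ b"
      and "C = ?P (Suc (a + b))"
    have nz: "A \<noteq> 0" "B \<noteq> 0" "?P a \<noteq> 0" "?P b \<noteq> 0"
      by (simp_all add: A_def B_def q_var_power_neq_1 qpoch_q_var_neq_0)
    have "1 - q_var * q_var ^ Suc (a + b) = A + q_var ^ Suc a * B"
      by (simp add: A_def B_def algebra_simps power_add)
    then have "?B i j = C * (A + q_var ^ Suc a * B) / (?P a * A * (?P b * B))"
      by (simp add: ab qpoch_Suc [of _ _ "Suc (a + b)"] qpoch_Suc [of _ _ a]
            qpoch_Suc [of _ _ b] A_def B_def C_def)
    also have "\<dots> = C / (?P a * (?P b * B)) + q_var ^ Suc a * (C / (?P a * A * ?P b))"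
      using nz by (simp add: divide_simps) (simp add: algebra_simps)
    also have "\<dots> = to_fract (u + monom 1 (Suc a) * v)"
      using u v by (simp add: qpoch_Suc [of _ _ a] qpoch_Suc [of _ _ b] A_def B_def C_def
          flip: q_var_power)
    finally show ?thesis by blast
  qed
qed

lemma q_exp_series_mult_inverse: "q_exp_series K * inverse (q_exp_series K) = 1"
proof -
  have "inverse (q_exp_series K) * q_exp_series K = 1"
    by (rule inverse_mult_eq_1) (simp add: q_exp_series_def)
  then show ?thesis by (simp add: mult.commute)
qed

lemma q_euler_integral:
  "qpoch q_var q_var j * fps_nth (inverse (q_exp_series K)) j \<in> range to_fract"
proof (induction j rule: less_induct)
  case (less j)
  let ?P = "qpoch q_var q_var" and ?F = "fps_nth (q_exp_series K)"
    and ?G = "fps_nth (inverse (q_exp_series K))"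
  have F0: "?F 0 = 1" by (simp add: q_exp_series_def)
  show ?case
  proof (cases "j = 0")
    case True
    have "to_fract (1 :: int poly) \<in> range to_fract" by blast
    with True F0 show ?thesis by simp
  next
    case False
    have "(\<Sum>i=0..j. ?F i * ?G (j - i)) = 0"
      using arg_cong [OF q_exp_series_mult_inverse [of K], of "\<lambda>f. fps_nth f j"] False
      by (simp add: fps_mult_nth)
    then have G: "?G j = - (\<Sum>i=1..j. ?F i * ?G (j - i))"
      using F0 by (simp add: sum.atLeast_Suc_atMost eq_neg_iff_add_eq_0)
    have "\<exists>p. to_fract p = ?P j * (?F i * ?G (j - i))" if i: "i \<in> {1..j}" for i
    proof (cases "K dvd i")
      case True
      obtain u where u: "?P j / (?P i * ?P (j - i)) = to_fract u"
        using q_binomial_integral [of i "j - i"] i by auto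
      obtain v where v: "?P (j - i) * ?G (j - i) = to_fract v"
        using less [of "j - i"] i by auto
      have "to_fract (u * v) = ?P j / (?P i * ?P (j - i)) * (?P (j - i) * ?G (j - i))"
        by (simp only: u v to_fract_mult)
      also have "\<dots> = ?P j * (?F i * ?G (j - i))"
        using True by (simp add: q_exp_series_def qpoch_q_var_neq_0)
      finally show ?thesis by blast
    next
      case False
      then have "to_fract (0 :: int poly) = ?P j * (?F i * ?G (j - i))"
        by (simp add: q_exp_series_def)
      then show ?thesis by blast
    qed
    then obtain p where "\<And>i. i \<in> {1..j} \<Longrightarrow> to_fract (p i) = ?P j * (?F i * ?G (j - i))"
      by metis
    then have "?P j * ?G j = to_fract (- (\<Sum>i=1..j. p i))"
      by (simp add: G sum_distrib_left)
    then show ?thesis by blast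
  qed
qed

lemma to_fract_q_euler:
  "to_fract (q_euler K j) = qpoch q_var q_var j * fps_nth (inverse (q_exp_series K)) j"
proof -
  have "\<exists>!p. to_fract p = qpoch q_var q_var j * fps_nth (inverse (q_exp_series K)) j"
    using q_euler_integral [of j K] by (metis rangeE to_fract_eq_iff)
  from theI' [OF this] show ?thesis by (simp add: q_euler_def)
qed

lemma q_euler_eq_0:
  assumes "\<not> K dvd j"
  shows "q_euler K j = 0"
proof -
  have "fps_nth (inverse (q_exp_series K)) j = 0"
    using assms
  proof (induction j rule: less_induct)
    case (less j)
    let ?F = "fps_nth (q_exp_series K)" and ?G = "fps_nth (inverse (q_exp_series K))"
    have "j \<noteq> 0" using less.prems by (metis dvd_0_right)
    then have "(\<Sum>i=0..j. ?F i * ?G (j - i)) = 0"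
      using arg_cong [OF q_exp_series_mult_inverse [of K], of "\<lambda>f. fps_nth f j"]
      by (simp add: fps_mult_nth)
    moreover have "?F 0 = 1" by (simp add: q_exp_series_def)
    moreover have "?F i * ?G (j - i) = 0" if "i \<in> {1..j}" for i
    proof (cases "K dvd i")
      case True
      then have "\<not> K dvd j - i" using less.prems that by (auto dest: dvd_diffD)
      then show ?thesis using less.IH [of "j - i"] that by auto
    qed (simp add: q_exp_series_def)
    ultimately show ?case by (simp add: sum.atLeast_Suc_atMost)
  qed
  then have "to_fract (q_euler K j) = 0" by (simp add: to_fract_q_euler)
  then show ?thesis by simp
qed

lemma q_euler_series:
  "Abs_fps (\<lambda>j. if K dvd j then to_fract (q_euler K j) / qpoch q_var q_var j else 0)
     = inverse (q_exp_series K)"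
proof (rule fps_ext)
  fix j
  show "fps_nth (Abs_fps (\<lambda>j. if K dvd j
           then to_fract (q_euler K j) / qpoch q_var q_var j else 0)) j
      = fps_nth (inverse (q_exp_series K)) j"
    using to_fract_q_euler [of K j] q_euler_eq_0 [of K j]
    by (auto simp: qpoch_q_var_neq_0)
qed

end

theory Submission
  imports Defs
begin

text \<open>
  Write \<open>K = 2 ^ k\<close>, \<open>H = K / 2\<close> and \<open>E m\<close> for \<open>q_euler K (K * m)\<close>. The modulus \<open>1 + q ^ (H * d)\<close> is monic with
  simple roots, so the congruence says that \<open>z ^ (- H * m) * E m\<close> and \<open>z ^ (- H * n) * E n\<close> agree at every complex
  \<open>z\<close> with \<open>z ^ (H * d) = -1\<close>. Such a \<open>z\<close> has order \<open>K * c\<close> with \<open>d / c\<close> odd, and the \<open>q\<close>-Lucas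
  theorem turns the recurrence for \<open>E\<close> into \<open>E (m + c) = - E m = z ^ (H * c) * E m\<close>. Hence
  \<open>z ^ (- H * m) * E m\<close> depends only on \<open>m\<close> modulo \<open>c\<close>, which gives one direction and reduces the
  other to \<open>0 \<le> n < m < d\<close>. There take \<open>z = exp (2 \<pi> i / (K d))\<close>: the numbers \<open>1 - z ^ j\<close> have modulus
  \<open>2 sin (\<pi> j / (K d))\<close>, and in the recurrence the term with \<open>E (m - 1)\<close> dominates, so that
  \<open>norm (E m)\<close> is strictly increasing for \<open>1 \<le> m < d\<close> (with a separate argument for \<open>K = 2\<close> and
  small \<open>d\<close>, where these bounds are not sharp enough).
\<close>

subsection \<open>Gaussian binomial coefficients\<close>

text \<open>Defined by the Pascal rule and not as a quotient of \<open>qpoch\<close> values, so that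
  it keeps its meaning at roots of unity, where that quotient can become 0/0.\<close>

fun qbinom :: "'a::comm_ring_1 \<Rightarrow> nat \<Rightarrow> nat \<Rightarrow> 'a" where
  "qbinom q n 0 = 1"
| "qbinom q 0 (Suc k) = 0"
| "qbinom q (Suc n) (Suc k) = qbinom q n k + q ^ Suc k * qbinom q n (Suc k)"

lemma qbinom_eq_0: "n < k \<Longrightarrow> qbinom q n k = 0"
  by (induction q n k rule: qbinom.induct) auto

lemma qbinom_self [simp]: "qbinom q n n = 1"
  by (induction n) (auto simp: qbinom_eq_0)

text \<open>The last factor splits as \<open>1 - q^(i+j) = (1 - q^i) + q^i * (1 - q^j)\<close>,
  which matches the Pascal rule. The division-free form stays valid where some \<open>qpoch\<close>
  vanishes.\<close>

lemma qpoch_add: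
  "qpoch q q (i + j) = qbinom q (i + j) i * (qpoch q q i * qpoch q q j)"
proof (induction "i + j" arbitrary: i j)
  case (Suc n)
  show ?case
  proof (cases "i = 0 \<or> j = 0")
    case False
    then obtain a b where ab: "i = Suc a" "j = Suc b" by (metis not0_implies_Suc)
    let ?P = "qpoch q q"
    have IH: "?P (a + Suc b) = qbinom q (a + Suc b) a * (?P a * ?P (Suc b))"
      "?P (Suc a + b) = qbinom q (Suc a + b) (Suc a) * (?P (Suc a) * ?P b)"
      using Suc.hyps(1)[of a "Suc b"] Suc.hyps(1)[of "Suc a" b] Suc.hyps(2) ab by auto
    have "?P (i + j) = ?P (a + Suc b) * (1 - q ^ Suc a) + q ^ Suc a * (?P (Suc a + b) * (1 - q ^ Suc b))"
      by (simp add: ab qpoch_Suc algebra_simps power_add)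
    also have "\<dots> = (qbinom q (a + Suc b) a + q ^ Suc a * qbinom q (a + Suc b) (Suc a))
        * (?P (Suc a) * ?P (Suc b))"
      unfolding IH by (simp add: qpoch_Suc algebra_simps)
    finally show ?thesis by (simp add: ab)
  qed auto
qed simp

lemma qpoch_eq_0_iff:
  fixes q :: "'a::idom"
  shows "qpoch q q n = 0 \<longleftrightarrow> (\<exists>j. 0 < j \<and> j \<le> n \<and> q ^ j = 1)"
proof -
  have "qpoch q q n = 0 \<longleftrightarrow> (\<exists>i<n. q ^ Suc i = 1)"
    by (auto simp: qpoch_def)
  also have "\<dots> \<longleftrightarrow> (\<exists>j. 0 < j \<and> j \<le> n \<and> q ^ j = 1)"
    by (metis Suc_le_eq gr0_conv_Suc zero_less_Suc)
  finally show ?thesis .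
qed

text \<open>The case of the \<open>q\<close>-Lucas theorem in which the top index grows by the order \<open>N\<close>.\<close>

lemma qbinom_add_order:
  fixes q :: "'a::idom"
  assumes N: "0 < N" "q ^ N = 1" and prim: "\<And>j. 0 < j \<Longrightarrow> j < N \<Longrightarrow> q ^ j \<noteq> 1"
  shows "qbinom q (N + n) k = qbinom q n k + (if N \<le> k then qbinom q n (k - N) else 0)"
proof (induction n arbitrary: k)
  case 0
  \<comment> \<open>\<open>qpoch q q N\<close> contains the factor \<open>1 - q^N = 0\<close>, while
    the two \<open>qpoch\<close> values on the right of \<open>qpoch_add\<close> have only nonzero
    factors.\<close>
  have "qbinom q N k = 0" if "0 < k" "k < N"
  proof -
    have "0 = qbinom q N k * (qpoch q q k * qpoch q q (N - k))"
      using qpoch_add[of q k "N - k"] qpoch_eq_0_iff[of q N] N that by auto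
    moreover have "qpoch q q k \<noteq> 0" "qpoch q q (N - k) \<noteq> 0"
      using that prim by (fastforce simp: qpoch_eq_0_iff)+
    ultimately show ?thesis by simp
  qed
  then show ?case
    using N by (cases "k = 0"; cases "k = N"; cases "k < N")
      (auto simp: qbinom_eq_0)
next
  case (Suc n)
  show ?case
  proof (cases k)
    case (Suc l)
    consider "Suc l < N" | "Suc l = N" | "N \<le> l" by linarith
    then show ?thesis
    proof cases
      case 2
      then have N': "N = Suc l" and "q ^ Suc l = 1" using N by simp_all
      then show ?thesis using Suc.IH[of l] Suc.IH[of "Suc l"]
        by (simp add: Suc N' del: power_Suc)
    next
      case 3
      \<comment> \<open>The shifted coefficients obey the Pascal rule with weight
        \<open>q^(Suc l - N)\<close>, which equals \<open>q^(Suc l)\<close>.\<close>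
      then have "q ^ l = q ^ (l - N)"
        using N by (metis le_add_diff_inverse mult_1 power_add)
      with 3 show ?thesis using Suc.IH[of l] Suc.IH[of "Suc l"]
        by (simp add: Suc Suc_diff_le algebra_simps)
    qed (use Suc.IH[of l] Suc.IH[of "Suc l"] N in \<open>auto simp: Suc algebra_simps\<close>)
  qed (use N in auto)
qed

lemma to_fract_power: "to_fract (p ^ n) = to_fract p ^ n"
  by (induction n) simp_all

lemma to_fract_qbinom:
  "to_fract (qbinom (monom 1 (Suc 0)) n k) = qbinom q_var n k"
  by (induction "monom 1 (Suc 0) :: int poly" n k rule: qbinom.induct)
    (simp_all add: q_var_def to_fract_power)


lemma q_var_qbinom:
  assumes "i \<le> n"
  shows "qbinom q_var n i = qpoch q_var q_var n / (qpoch q_var q_var i * qpoch q_var q_var (n - i))"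
  using qpoch_add[of q_var i "n - i"] assms by (simp add: qpoch_q_var_neq_0)

text \<open>Comparing coefficients of \<open>x^(K*m)\<close> in series times inverse and multiplying
  by \<open>(q;q)_(K*m)\<close> leaves a recurrence without denominators. It can be specialised at
  any number, roots of unity included.\<close>

lemma sum_qbinom_q_euler:
  assumes "K > 0"
  shows "(\<Sum>n\<le>m. qbinom (monom 1 (Suc 0)) (K * m) (K * n) * q_euler K (K * n)) = (if m = 0 then 1 else 0)"
proof -
  let ?P = "qpoch q_var q_var" and ?F = "fps_nth (q_exp_series K)"
    and ?G = "fps_nth (inverse (q_exp_series K))"
  have "(if m = 0 then 1 else 0) = ?P (K * m) * (if K * m = 0 then 1 else 0)"
    using assms by simp
  also have "(if K * m = 0 then 1 else 0) = (\<Sum>i=0..K * m. ?G i * ?F (K * m - i))"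
    using arg_cong[OF q_exp_series_mult_inverse[of K], of "\<lambda>f. fps_nth f (K * m)"]
    by (simp add: fps_mult_nth mult.commute[of "q_exp_series K"])
  also have "\<dots> = (\<Sum>i\<in>(\<lambda>n. K * n) ` {..m}. ?G i * ?F (K * m - i))"
  proof (rule sum.mono_neutral_right)
    show "\<forall>i\<in>{0..K * m} - (\<lambda>n. K * n) ` {..m}. ?G i * ?F (K * m - i) = 0"
    proof safe
      fix i assume i: "i \<in> {0..K * m}" "i \<notin> (\<lambda>n. K * n) ` {..m}"
      have "\<not> K dvd i" using i assms by (auto elim!: dvdE)
      then have "\<not> K dvd K * m - i" using i
        by (metis atLeastAtMost_iff dvd_diffD1 dvd_triv_left)
      then show "?G i * ?F (K * m - i) = 0" by (simp add: q_exp_series_def)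
    qed
  qed auto
  also have "\<dots> = (\<Sum>n\<le>m. ?G (K * n) * ?F (K * m - K * n))"
    using assms by (subst sum.reindex) (auto simp: inj_on_def)
  also have "?P (K * m) * \<dots> = (\<Sum>n\<le>m. qbinom q_var (K * m) (K * n) * to_fract (q_euler K (K * n)))"
    unfolding sum_distrib_left
  proof (rule sum.cong)
    fix n assume "n \<in> {..m}"
    moreover have "K dvd K * m - K * n" by (simp flip: diff_mult_distrib2)
    ultimately show "?P (K * m) * (?G (K * n) * ?F (K * m - K * n))
        = qbinom q_var (K * m) (K * n) * to_fract (q_euler K (K * n))"
      by (simp add: q_var_qbinom to_fract_q_euler q_exp_series_def qpoch_q_var_neq_0)
  qed simp
  also have "\<dots> = to_fract (\<Sum>n\<le>m. qbinom (monom 1 (Suc 0)) (K * m) (K * n) * q_euler K (K * n))"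
    by (simp add: to_fract_qbinom)
  finally show ?thesis
    by (metis (no_types, lifting) to_fract_0 to_fract_1 to_fract_eq_iff)
qed

subsection \<open>Evaluation at a number\<close>

text \<open>The target ring is kept general: complex roots of the modulus, reals and the integer 3
  all occur as \<open>z\<close>.\<close>

definition eval_at :: "'a::comm_ring_1 \<Rightarrow> int poly \<Rightarrow> 'a" where
  "eval_at z p = poly (map_poly of_int p) z"

lemma eval_at_pCons: "eval_at z (pCons a p) = of_int a + z * eval_at z p"
  by (simp add: eval_at_def map_poly_pCons)

lemma eval_at_0 [simp]: "eval_at z 0 = 0"
  by (simp add: eval_at_def)

lemma eval_at_1 [simp]: "eval_at z 1 = 1"
  by (simp add: eval_at_def)

lemma eval_at_add [simp]: "eval_at z (p + r) = eval_at z p + eval_at z r"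
  by (induction p r rule: poly_induct2) (simp_all add: eval_at_pCons algebra_simps)

lemma eval_at_smult [simp]: "eval_at z (smult a p) = of_int a * eval_at z p"
  by (induction p) (simp_all add: eval_at_pCons algebra_simps)

lemma eval_at_mult [simp]: "eval_at z (p * r) = eval_at z p * eval_at z r"
  by (induction p) (simp_all add: eval_at_pCons algebra_simps)

lemma eval_at_diff [simp]: "eval_at z (p - r) = eval_at z p - eval_at z r"
  using eval_at_add[of z "p - r" r] by simp

lemma eval_at_monom [simp]: "eval_at z (monom a n) = of_int a * z ^ n"
  by (induction n) (simp_all add: monom_0 monom_Suc eval_at_pCons)

lemma eval_at_power [simp]: "eval_at z (p ^ n) = eval_at z p ^ n"
  by (induction n) simp_all

lemma eval_at_sum [simp]: "eval_at z (sum f A) = (\<Sum>x\<in>A. eval_at z (f x))"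
  by (induction A rule: infinite_finite_induct) simp_all

lemma eval_at_qbinom: "eval_at z (qbinom (monom 1 (Suc 0)) n k) = qbinom z n k"
  by (induction "monom 1 (Suc 0) :: int poly" n k rule: qbinom.induct)
    (simp_all add: algebra_simps)

definition euler_at :: "nat \<Rightarrow> 'a::comm_ring_1 \<Rightarrow> nat \<Rightarrow> 'a" where
  "euler_at K z m = eval_at z (q_euler K (K * m))"

lemma sum_qbinom_euler_at:
  assumes "K > 0"
  shows "(\<Sum>n\<le>m. qbinom z (K * m) (K * n) * euler_at K z n) = (if m = 0 then 1 else 0)"
  using arg_cong[OF sum_qbinom_q_euler[OF assms, of m], of "eval_at z"]
  by (simp add: euler_at_def eval_at_qbinom split: if_splits)

lemma euler_at_0 [simp]: "K > 0 \<Longrightarrow> euler_at K z 0 = 1"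
  using sum_qbinom_euler_at[of K z 0] by simp

lemma euler_at_1: "K > 0 \<Longrightarrow> euler_at K z (Suc 0) = -1"
  using sum_qbinom_euler_at[of K z 1] by (simp add: eq_neg_iff_add_eq_0 add.commute)

text \<open>By \<open>qbinom_add_order\<close> every binomial with top index
  \<open>K*c + K*m\<close> splits in two, and the recurrence at \<open>m + c > 0\<close> says that
  the sum of \<open>?B n * (?E n + ?E (n + c))\<close> over \<open>n \<le> m\<close> is 0. By
  induction only the summand \<open>n = m\<close> survives.\<close>

lemma euler_at_add_order:
  fixes z :: "'a::idom"
  assumes K: "K > 0" and c: "c > 0" "z ^ (K * c) = 1"
    and prim: "\<And>j. 0 < j \<Longrightarrow> j < K * c \<Longrightarrow> z ^ j \<noteq> 1"
  shows "euler_at K z (m + c) = - euler_at K z m"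
proof (induction m rule: less_induct)
  case (less m)
  let ?E = "euler_at K z" and ?B = "\<lambda>n. qbinom z (K * m) (K * n)"
  have "0 = (\<Sum>n\<le>m + c. qbinom z (K * c + K * m) (K * n) * ?E n)"
    using sum_qbinom_euler_at[OF K, where z = z and m = "m + c"] c
    by (simp add: algebra_simps)
  also have "\<dots> = (\<Sum>n\<le>m + c. ?B n * ?E n + (if c \<le> n then ?B (n - c) * ?E n else 0))"
    using K c by (intro sum.cong refl)
      (simp add: qbinom_add_order[of "K * c" z] prim algebra_simps diff_mult_distrib2)
  also have "\<dots> = (\<Sum>n\<le>m + c. ?B n * ?E n) + (\<Sum>n\<le>m + c. if c \<le> n then ?B (n - c) * ?E n else 0)"
    by (rule sum.distrib)
  also have "(\<Sum>n\<le>m + c. ?B n * ?E n) = (\<Sum>n\<le>m. ?B n * ?E n)"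
    using K by (intro sum.mono_neutral_right) (auto simp: qbinom_eq_0)
  also have "(\<Sum>n\<le>m + c. if c \<le> n then ?B (n - c) * ?E n else 0) = (\<Sum>n\<in>{c..m + c}. ?B (n - c) * ?E n)"
    by (intro sum.mono_neutral_cong_right) auto
  also have "\<dots> = (\<Sum>n\<le>m. ?B n * ?E (n + c))"
    by (rule sum.reindex_bij_witness[of _ "\<lambda>n. n + c" "\<lambda>n. n - c"]) auto
  finally have "(\<Sum>n\<le>m. ?B n * (?E n + ?E (n + c))) = 0"
    by (simp add: sum.distrib algebra_simps)
  moreover have "(\<Sum>n\<le>m. ?B n * (?E n + ?E (n + c))) = ?E m + ?E (m + c)"
    using less by (simp add: sum.remove[of "{..m}" m])
  ultimately show ?case by (simp add: eq_neg_iff_add_eq_0 add.commute)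
qed

subsection \<open>Values at the roots of the modulus\<close>

text \<open>As the modulus is monic, pseudo-division is division with remainder over the integers.
  The remainder has degree below \<open>n\<close> but vanishes at all \<open>n\<close> complex
  solutions of \<open>z^n = -1\<close>.\<close>

lemma dvd_iff_eval_at_roots:
  assumes "n > 0"
  shows "(1 + monom 1 n :: int poly) dvd p \<longleftrightarrow> (\<forall>z::complex. z ^ n = -1 \<longrightarrow> eval_at z p = 0)"
    (is "?M dvd p \<longleftrightarrow> ?R")
proof
  assume "?M dvd p"
  then obtain s where "p = ?M * s" by (elim dvdE)
  then show ?R by simp
next
  assume R: ?R
  have deg: "degree ?M = n"
    using assms by (simp add: degree_add_eq_right degree_monom_eq)
  have lc: "coeff ?M n = 1"
    using assms by simp
  have "?M \<noteq> 0" using deg assms by auto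
  obtain s r where sr: "pseudo_divmod p ?M = (s, r)" by fastforce
  from pseudo_divmod[OF \<open>?M \<noteq> 0\<close> sr] have p: "p = ?M * s + r" and r: "r = 0 \<or> degree r < n"
    by (simp_all only: deg lc power_one smult_1_left)
  have "map_poly of_int r = (0 :: complex poly)"
  proof (rule poly_eqI_degree)
    show "poly (map_poly of_int r) z = poly 0 z" if "z \<in> {z::complex. z ^ n = -1}" for z
      using R that p by (simp flip: eval_at_def)
    have "card {z::complex. z ^ n = -1} = n"
      using assms by (intro card_nth_roots) auto
    then show "card {z::complex. z ^ n = -1} > degree (map_poly of_int r :: complex poly)"
      "card {z::complex. z ^ n = -1} > degree (0 :: complex poly)"
      using r assms map_poly_degree_leq[of "of_int :: int \<Rightarrow> complex" r] by auto
  qed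
  then have "r = 0" by (subst (asm) map_poly_eq_0_iff) auto
  then show "?M dvd p" using p by simp
qed

lemma primitive_order:
  fixes z :: "'a::idom"
  assumes "z ^ n = 1" "n > 0"
  obtains N where "N > 0" "z ^ N = 1" "\<And>j. 0 < j \<Longrightarrow> j < N \<Longrightarrow> z ^ j \<noteq> 1" "\<And>j. z ^ j = 1 \<Longrightarrow> N dvd j"
proof -
  define N where "N = (LEAST j. 0 < j \<and> z ^ j = 1)"
  have N: "N > 0" "z ^ N = 1"
    using LeastI[of "\<lambda>j. 0 < j \<and> z ^ j = 1" n] assms by (auto simp: N_def)
  have prim: "z ^ j \<noteq> 1" if "0 < j" "j < N" for j
    using not_less_Least[of j "\<lambda>j. 0 < j \<and> z ^ j = 1"] that by (auto simp: N_def)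
  have "N dvd j" if "z ^ j = 1" for j
  proof (rule ccontr)
    assume "\<not> N dvd j"
    have "z ^ j = (z ^ N) ^ (j div N) * z ^ (j mod N)"
      by (simp flip: power_mult power_add)
    then have "z ^ (j mod N) = 1" using N that by simp
    moreover have "0 < j mod N" "j mod N < N" using N \<open>\<not> N dvd j\<close> by (auto simp: mod_greater_zero_iff_not_dvd)
    ultimately show False using prim by blast
  qed
  with N prim show thesis by (intro that)
qed

lemma euler_at_periodic:
  fixes z :: "'a::{idom,ring_char_0}"
  assumes k: "k \<ge> 1" and d: "d > 0" and z: "z ^ (2 ^ (k - 1) * d) = -1"
  shows "euler_at (2 ^ k) z (n + d * j) = z ^ (2 ^ (k - 1) * (d * j)) * euler_at (2 ^ k) z n"
proof -
  define H :: nat where "H = 2 ^ (k - 1)"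
  have K: "2 ^ k = 2 * H" using k by (simp add: H_def flip: power_Suc)
  have "H > 0" by (simp add: H_def)
  have "z ^ (2 ^ k * d) = (z ^ (H * d)) ^ 2" by (simp add: K mult_ac flip: power_mult)
  then have "z ^ (2 ^ k * d) = 1" using z by (simp add: H_def)
  then obtain N where N: "N > 0" "z ^ N = 1" "\<And>j. 0 < j \<Longrightarrow> j < N \<Longrightarrow> z ^ j \<noteq> 1"
      "\<And>j. z ^ j = 1 \<Longrightarrow> N dvd j"
    using primitive_order[of z "2 ^ k * d"] d by auto
  obtain t where t: "2 ^ k * d = N * t" using N(4) \<open>z ^ (2 ^ k * d) = 1\<close> by (auto elim: dvdE)
  have "odd t" \<comment> \<open>so that the full power of 2 divides the order \<open>N\<close>\<close>
  proof
    assume "even t"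
    then have "H * d = N * (t div 2)" using t by (auto simp: K elim!: evenE)
    then have "z ^ (H * d) = 1" using N(2) by (simp add: power_mult)
    then show False using z by (simp add: H_def)
  qed
  then have "coprime (2 ^ k) t" by simp
  then have "2 ^ k dvd N" using t by (metis coprime_dvd_mult_left_iff dvd_triv_left)
  then obtain c where c: "N = 2 ^ k * c" by (elim dvdE)
  have "c > 0" using N(1) c by simp
  have "d = c * t" using t c by simp
  \<comment> \<open>\<open>z^(H*c)\<close> is a square root of 1 whose exponent lies below the
    order, hence -1. So the sign in \<open>euler_at_add_order\<close> is \<open>z^(H*c)\<close>, and
    a shift by \<open>d * j\<close> is \<open>t * j\<close> shifts by \<open>c\<close>.\<close>
  have "(z ^ (H * c)) ^ 2 = 1" using N(2) by (simp add: c K mult_ac flip: power_mult)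
  moreover have "z ^ (H * c) \<noteq> 1"
    using N(3)[of "H * c"] \<open>c > 0\<close> \<open>H > 0\<close> by (simp add: c K)
  ultimately have Hc: "z ^ (H * c) = -1" by (simp add: power2_eq_1_iff)
  have "euler_at (2 ^ k) z (n + c * i) = z ^ (H * (c * i)) * euler_at (2 ^ k) z n" for i
  proof (induction i)
    case (Suc i)
    have "euler_at (2 ^ k) z (n + c * i + c) = - euler_at (2 ^ k) z (n + c * i)"
      by (rule euler_at_add_order) (use \<open>c > 0\<close> N c in auto)
    then show ?case
      using Suc Hc by (simp add: algebra_simps power_add)
  qed simp
  from this[of "t * j"] show ?thesis
    by (simp add: \<open>d = c * t\<close> H_def mult.assoc)
qed

subsection \<open>Growth at the first primitive root of unity\<close>

text \<open>If \<open>c\<close> bounds the earlier ratios \<open>norm (a (Suc j)) / (norm (f 1) * norm (a j))\<close> from below, then by \<open>tail\<close>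
  the summand with \<open>i = 0\<close> dominates the others so much that \<open>c\<close> also bounds the next ratio.\<close>

lemma recurrence_growth:
  fixes a f :: "nat \<Rightarrow> 'a::real_normed_field" and c :: real
  assumes rec: "\<And>m. m < M \<Longrightarrow> a (Suc m) = - (\<Sum>i\<le>m. f (Suc i) * a (m - i))"
    and c: "c > 0" "f 1 \<noteq> 0"
    and tail: "(\<Sum>i=1..<M. norm (f (Suc i)) / (c * norm (f 1)) ^ i) \<le> (1 - c) * norm (f 1)"
    and m: "m < M"
  shows "norm (a (Suc m)) \<ge> c * norm (f 1) * norm (a m)"
  using m
proof (induction m rule: less_induct)
  case (less m)
  define x where "x = c * norm (f 1)"
  have x: "x > 0" using c by (simp add: x_def)
  \<comment> \<open>The induction hypothesis chained \<open>i\<close> times: going back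
    \<open>i\<close> places divides the norm by at least \<open>x^i\<close>.\<close>
  have down: "x ^ i * norm (a (m - i)) \<le> norm (a m)" if "i \<le> m" for i
    using that
  proof (induction i)
    case (Suc i)
    have "x * norm (a (m - Suc i)) \<le> norm (a (Suc (m - Suc i)))"
      unfolding x_def using Suc.prems less.prems by (intro less.IH) auto
    also have "Suc (m - Suc i) = m - i" using Suc.prems by simp
    finally have "x ^ i * (x * norm (a (m - Suc i))) \<le> x ^ i * norm (a (m - i))"
      using x by (intro mult_left_mono) auto
    also have "\<dots> \<le> norm (a m)" using Suc by simp
    finally show ?case by (simp add: mult_ac)
  qed simp
  have "norm (\<Sum>i=1..m. f (Suc i) * a (m - i)) \<le> (\<Sum>i=1..m. norm (f (Suc i)) / x ^ i * norm (a m))"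
  proof (rule sum_norm_le)
    fix i assume i: "i \<in> {1..m}"
    have "norm (a (m - i)) \<le> norm (a m) / x ^ i"
      using down[of i] i x by (simp add: field_simps)
    then have "norm (f (Suc i)) * norm (a (m - i)) \<le> norm (f (Suc i)) * (norm (a m) / x ^ i)"
      by (intro mult_left_mono) auto
    then show "norm (f (Suc i) * a (m - i)) \<le> norm (f (Suc i)) / x ^ i * norm (a m)"
      by (simp add: norm_mult)
  qed
  also have "\<dots> = (\<Sum>i=1..m. norm (f (Suc i)) / x ^ i) * norm (a m)"
    by (rule sum_distrib_right [symmetric])
  also have "\<dots> \<le> (\<Sum>i=1..<M. norm (f (Suc i)) / x ^ i) * norm (a m)"
    using x less.prems by (intro mult_right_mono sum_mono2) auto
  also have "\<dots> \<le> (1 - c) * norm (f 1) * norm (a m)"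
    using tail by (intro mult_right_mono) (auto simp: x_def)
  finally have bound: "norm (\<Sum>i=1..m. f (Suc i) * a (m - i)) \<le> (1 - c) * norm (f 1) * norm (a m)" .
  have "(\<Sum>i\<le>m. f (Suc i) * a (m - i)) = f 1 * a m + (\<Sum>i=1..m. f (Suc i) * a (m - i))"
    by (subst atMost_atLeast0, subst sum.atLeast_Suc_atMost) simp_all
  then have "norm (f 1 * a m) = norm (a (Suc m) + (\<Sum>i=1..m. f (Suc i) * a (m - i)))"
    using rec[OF less.prems] by simp
  also have "\<dots> \<le> norm (a (Suc m)) + (1 - c) * norm (f 1) * norm (a m)"
    using bound norm_triangle_ineq[of "a (Suc m)" "\<Sum>i=1..m. f (Suc i) * a (m - i)"] by linarith
  finally show ?case by (simp add: norm_mult algebra_simps)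
qed

lemma sum_le_geometric:
  fixes T :: "nat \<Rightarrow> real"
  assumes "\<And>i. a \<le> i \<Longrightarrow> i < n \<Longrightarrow> T (Suc i) \<le> r * T i" and "0 \<le> r" "r < 1" "a \<le> n"
    and "T n \<ge> 0"
  shows "(\<Sum>i=a..n. T i) \<le> T a / (1 - r)"
proof -
  \<comment> \<open>The induction carries the geometric bound for everything after \<open>k\<close>,
    so that the right-hand side stays fixed.\<close>
  have "(\<Sum>i=a..k. T i) + T k * r / (1 - r) \<le> T a / (1 - r)" if "a \<le> k" "k \<le> n" for k
    using that
  proof (induction k rule: dec_induct)
    case base
    then show ?case using assms(3) by (simp add: field_simps)
  next
    case (step k)
    have "T (Suc k) + T (Suc k) * r / (1 - r) = T (Suc k) / (1 - r)"
      using assms(3) by (simp add: field_simps)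
    also have "\<dots> \<le> T k * r / (1 - r)"
      using assms(3) assms(1)[of k] step by (intro divide_right_mono) (auto simp: mult.commute)
    finally show ?case using step by simp
  qed
  from this[of n] have "(\<Sum>i=a..n. T i) + T n * r / (1 - r) \<le> T a / (1 - r)"
    using \<open>a \<le> n\<close> by simp
  moreover have "T n * r / (1 - r) \<ge> 0" using assms by simp
  ultimately show ?thesis by linarith
qed

text \<open>Division by \<open>qpoch z z (K * m)\<close> turns the recurrence into a plain
  convolution, as long as no power of \<open>z\<close> up to that index is 1.\<close>

lemma euler_at_rec:
  fixes z :: "'a::field"
  assumes "K > 0" "\<And>j. j \<le> m \<Longrightarrow> qpoch z z (K * j) \<noteq> 0"
  shows "(\<Sum>n\<le>m. euler_at K z n / (qpoch z z (K * n) * qpoch z z (K * (m - n)))) = (if m = 0 then 1 else 0)"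
proof -
  let ?P = "\<lambda>j. qpoch z z (K * j)"
  have "(\<Sum>n\<le>m. euler_at K z n / (?P n * ?P (m - n)))
      = (\<Sum>n\<le>m. qbinom z (K * m) (K * n) * euler_at K z n / ?P m)"
  proof (rule sum.cong)
    fix n assume "n \<in> {..m}"
    then have "?P m = qbinom z (K * m) (K * n) * (?P n * ?P (m - n))"
      using qpoch_add[of z "K * n" "K * (m - n)"] by (simp flip: distrib_left)
    moreover have "?P m \<noteq> 0" "?P n \<noteq> 0" "?P (m - n) \<noteq> 0"
      using \<open>n \<in> {..m}\<close> assms(2) by auto
    ultimately show "euler_at K z n / (?P n * ?P (m - n)) = qbinom z (K * m) (K * n) * euler_at K z n / ?P m"
      by (auto simp: field_simps)
  qed simp
  also have "\<dots> = (if m = 0 then 1 else 0)"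
    using sum_qbinom_euler_at[OF assms(1), where z = z and m = m]
    by (simp flip: sum_divide_distrib)
  finally show ?thesis .
qed

section \<open>Norms of q-factorials as products of sines\<close>

lemma norm_one_minus_cis: "norm (1 - cis t) = 2 * \<bar>sin (t / 2)\<bar>"
proof -
  have "(norm (1 - cis t))\<^sup>2 = (1 - cos t)\<^sup>2 + (sin t)\<^sup>2"
    by (simp add: cmod_power2)
  also have "\<dots> = 2 - 2 * cos t"
    by (simp add: power2_diff sin_squared_eq)
  also have "\<dots> = (2 * \<bar>sin (t / 2)\<bar>)\<^sup>2"
    using cos_double_sin[of "t / 2"] by (simp add: power_mult_distrib)
  finally show ?thesis by (rule power2_eq_imp_eq) auto
qed

lemma sin_ge_sin:
  assumes "0 \<le> a" "a \<le> x" "x \<le> pi - a"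
  shows "sin a \<le> sin x"
proof (cases "x \<le> pi / 2")
  case True
  then show ?thesis using assms by (intro sin_monotone_2pi_le) auto
next
  case False
  have "sin a \<le> sin (pi - x)"
    using assms False by (intro sin_monotone_2pi_le) auto
  then show ?thesis by simp
qed

text \<open>Half the distance from 1 to \<open>z^j\<close> for \<open>z = cis (2 * pi / N)\<close>
  and \<open>j \<le> N\<close>.\<close>

definition root_sin :: "nat \<Rightarrow> nat \<Rightarrow> real" where
  "root_sin N j = sin (pi * j / N)"

text \<open>The defect of multiplicativity: for \<open>1 \<le> l < d\<close> the norm of
  \<open>qpoch z z (K * l)\<close> is the product of those at \<open>K * (l - 1)\<close> and
  \<open>K\<close>, times this factor.\<close>

definition sin_ratio :: "nat \<Rightarrow> nat \<Rightarrow> nat \<Rightarrow> real" where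
  "sin_ratio K d l = (\<Prod>i=1..K. root_sin (K * d) (K * (l - 1) + i) / root_sin (K * d) i)"

lemma root_sin_pos: "0 < j \<Longrightarrow> j < N \<Longrightarrow> root_sin N j > 0"
  unfolding root_sin_def by (intro sin_gt_zero) (auto simp: divide_less_eq)

lemma root_sin_le:
  assumes "0 < N" "i \<le> j" "i + j \<le> N"
  shows "root_sin N i \<le> root_sin N j"
  unfolding root_sin_def
proof (rule sin_ge_sin)
  have "pi * real j \<le> pi * (real N - real i)"
    using assms(3) by (intro mult_left_mono) auto
  then show "pi * j / N \<le> pi - pi * i / N"
    using assms(1) by (simp add: field_simps)
qed (use assms in \<open>auto intro!: divide_right_mono\<close>)

text \<open>\<open>recurrence_growth\<close> with \<open>c = 3/5\<close> is applied to
  \<open>euler_at\<close> divided by \<open>qpoch\<close>. Clearing the denominators multiplies the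
  lower bound by \<open>\<beta> (Suc m)\<close>, and \<open>3/5 * \<beta> (Suc m) > 1\<close>. The
  2/5 in the tail is \<open>1 - c\<close>.\<close>

lemma growth_criterion:
  fixes K d :: nat
  defines "\<beta> \<equiv> sin_ratio K d" and "z \<equiv> cis (2 * pi / real (K * d))"
  assumes K: "K > 0" and d: "d \<ge> 3"
    and \<beta>: "\<And>l. 2 \<le> l \<Longrightarrow> l < d \<Longrightarrow> \<beta> l > 5 / 3"
    and tail: "(\<Sum>i=1..<d - 1. (\<Prod>l=2..Suc i. 5 / 3 / \<beta> l)) \<le> 2 / 5"
    and m: "1 \<le> m" "Suc m < d" and nz: "euler_at K z m \<noteq> 0"
  shows "norm (euler_at K z m) < norm (euler_at K z (Suc m))"
proof -
  let ?s = "root_sin (K * d)"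
  define p where "p j = (\<Prod>i=1..j. 2 * ?s i)" for j
  have p_pos: "p j > 0" if "j < K * d" for j
    unfolding p_def using that by (intro prod_pos) (auto intro!: root_sin_pos)
  have norm_P: "norm (qpoch z z j) = p j" if "j < K * d" for j
  proof -
    have "norm (1 - z * z ^ i) = 2 * ?s (Suc i)" if "i < j" for i
    proof -
      have "z * z ^ i = cis (2 * (pi * Suc i / real (K * d)))"
        unfolding power_Suc[symmetric] unfolding z_def Complex.DeMoivre by (simp add: mult_ac)
      moreover have "?s (Suc i) > 0" using that \<open>j < K * d\<close> by (intro root_sin_pos) auto
      ultimately show ?thesis using norm_one_minus_cis by (simp add: root_sin_def)
    qed
    then have "norm (qpoch z z j) = (\<Prod>i<j. 2 * ?s (Suc i))"
      by (simp add: qpoch_def flip: prod_norm)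
    also have "\<dots> = p j"
      unfolding p_def by (rule prod.reindex_bij_witness[of _ "\<lambda>i. i - 1" Suc]) auto
    finally show ?thesis .
  qed
  have p_add: "p (j + n) = p j * (\<Prod>i=1..n. 2 * ?s (j + i))" for j n
    by (induction n) (simp_all add: p_def)
  have p_step: "p (K * Suc l) = p (K * l) * p K * \<beta> (Suc l)" if "Suc l < d" for l
  proof -
    have "p K * \<beta> (Suc l) = (\<Prod>i=1..K. 2 * ?s i * (?s (K * l + i) / ?s i))"
      unfolding p_def \<beta>_def sin_ratio_def by (subst prod.distrib [symmetric]) simp
    also have "\<dots> = (\<Prod>i=1..K. 2 * ?s (K * l + i))"
    proof (rule prod.cong)
      fix i assume i: "i \<in> {1..K}"
      have "K < K * d" using K d by simp
      then have "i < K * d" using i by (meson atLeastAtMost_iff le_less_trans)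
      then have "?s i > 0" using i by (intro root_sin_pos) auto
      then show "2 * ?s i * (?s (K * l + i) / ?s i) = 2 * ?s (K * l + i)" by simp
    qed simp
    finally show ?thesis using p_add[of "K * l" K] by (simp add: mult.assoc add.commute)
  qed
  have lt: "K * j < K * d" if "j < d" for j
    using that K by simp
  have P_nz: "qpoch z z (K * j) \<noteq> 0" if "j < d" for j
    using norm_P[OF lt[OF that]] p_pos[OF lt[OF that]] by auto
  define a where "a j = euler_at K z j / qpoch z z (K * j)" for j
  define f where "f j = 1 / qpoch z z (K * j)" for j
  have norm_f: "norm (f j) = 1 / p (K * j)" if "j < d" for j
    using norm_P[OF lt[OF that]] by (simp add: f_def norm_divide)
  define x where "x = 3 / 5 * norm (f 1)"
  have f1: "norm (f 1) = 1 / p K" "norm (f 1) > 0" "p K > 0"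
    using norm_f[of 1] p_pos[of K] lt[of 1] d by auto
  \<comment> \<open>Passing from \<open>i\<close> to \<open>Suc i\<close> divides the norm of
    \<open>f\<close> by \<open>p K * \<beta> (Suc (Suc i))\<close> and gains
    \<open>1 / x = 5/3 * p K\<close>, so \<open>p K\<close> cancels.\<close>
  have T: "norm (f (Suc i)) / x ^ i = norm (f 1) * (\<Prod>l=2..Suc i. 5 / 3 / \<beta> l)" if "Suc i < d" for i
    using that
  proof (induction i)
    case (Suc i)
    have "norm (f (Suc (Suc i))) / x ^ Suc i = norm (f (Suc i)) / x ^ i * (5 / 3 / \<beta> (Suc (Suc i)))"
      using norm_f[of "Suc (Suc i)"] norm_f[of "Suc i"] p_step[of "Suc i"] Suc.prems f1
      by (simp add: x_def field_simps)
    then show ?case using Suc by (simp add: prod.nat_ivl_Suc')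
  qed simp
  have "3 / 5 * norm (f 1) * norm (a m) \<le> norm (a (Suc m))"
  proof (rule recurrence_growth)
    fix m assume m: "m < d - 1"
    \<comment> \<open>All indices stay below \<open>d\<close>, so no denominator vanishes; the top
      summand is \<open>a (Suc m)\<close> because \<open>f 0 = 1\<close>.\<close>
    have "0 = (\<Sum>n\<le>Suc m. a n * f (Suc m - n))"
      using euler_at_rec[of K "Suc m" z] K P_nz m by (simp add: a_def f_def)
    also have "\<dots> = a (Suc m) + (\<Sum>n\<le>m. a n * f (Suc m - n))"
      by (simp add: f_def)
    also have "(\<Sum>n\<le>m. a n * f (Suc m - n)) = (\<Sum>i\<le>m. f (Suc i) * a (m - i))"
      by (rule sum.reindex_bij_witness[of _ "\<lambda>n. m - n" "\<lambda>n. m - n"]) (auto simp: Suc_diff_le mult.commute)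
    finally show "a (Suc m) = - (\<Sum>i\<le>m. f (Suc i) * a (m - i))"
      by (simp add: eq_neg_iff_add_eq_0)
  next
    have "(\<Sum>i=1..<d - 1. norm (f (Suc i)) / x ^ i) = norm (f 1) * (\<Sum>i=1..<d - 1. (\<Prod>l=2..Suc i. 5 / 3 / \<beta> l))"
      unfolding sum_distrib_left by (intro sum.cong T) auto
    also have "\<dots> \<le> norm (f 1) * (2 / 5)"
      using tail by (intro mult_left_mono) auto
    finally show "(\<Sum>i=1..<d - 1. norm (f (Suc i)) / (3 / 5 * norm (f 1)) ^ i) \<le> (1 - 3 / 5) * norm (f 1)"
      by (simp add: x_def)
  qed (use f1 m in auto)
  then have "3 / 5 / p K * (norm (euler_at K z m) / p (K * m)) \<le> norm (euler_at K z (Suc m)) / p (K * Suc m)"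
    using norm_P[OF lt[of m]] norm_P[OF lt[of "Suc m"]] m f1(1)
    by (simp add: a_def norm_divide mult_ac del: mult_Suc_right)
  moreover have "p (K * Suc m) = p (K * m) * p K * \<beta> (Suc m)" using p_step m by simp
  moreover have "p (K * m) > 0" "p K > 0" "\<beta> (Suc m) > 5 / 3"
    using m f1 \<beta>[of "Suc m"] p_pos lt by auto
  ultimately have "3 / 5 * \<beta> (Suc m) * norm (euler_at K z m) \<le> norm (euler_at K z (Suc m))"
    by (simp add: field_simps)
  moreover have "norm (euler_at K z m) < 3 / 5 * \<beta> (Suc m) * norm (euler_at K z m)"
    using \<open>\<beta> (Suc m) > 5 / 3\<close> nz by simp
  ultimately show ?thesis by linarith
qed

section \<open>Trigonometric lower bounds for the ratios\<close>

lemma sin_triple: "sin (3 * x) = sin x * ((2 * cos x)\<^sup>2 - 1)" for x :: real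
proof -
  have "sin (3 * x) = sin (2 * x + x)" by simp
  also have "\<dots> = sin x * ((2 * cos x)\<^sup>2 - 1)"
    unfolding sin_add sin_double cos_double_cos by (simp add: algebra_simps power2_eq_square)
  finally show ?thesis .
qed

lemma sin_quadruple: "sin (4 * x) = sin (2 * x) * ((2 * cos x)\<^sup>2 - 2)" for x :: real
proof -
  have "(2 * cos x)\<^sup>2 - 2 = 2 * cos (2 * x)" by (simp add: cos_double_cos power_mult_distrib)
  then show ?thesis using sin_double[of "2 * x"] by simp
qed

lemma sin_quintuple:
  "sin (5 * x) = sin x * ((2 * cos (2 * x))\<^sup>2 + 2 * cos (2 * x) - 1)" for x :: real
proof -
  have "sin (5 * x) = sin (3 * x + 2 * x)" by simp
  also have "\<dots> = sin x * ((2 * cos (2 * x))\<^sup>2 + 2 * cos (2 * x) - 1)"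
  proof -
    have s2: "(sin x)\<^sup>2 = 1 - (cos x)\<^sup>2" by (simp add: sin_squared_eq)
    have "cos (3 * x) = cos (2 * x + x)" by simp
    also have "\<dots> = cos x * (2 * (cos x)\<^sup>2 - 1) - 2 * cos x * (sin x)\<^sup>2"
      unfolding cos_add sin_double cos_double_cos by (simp add: algebra_simps power2_eq_square)
    finally have c3: "cos (3 * x) = cos x * (4 * (cos x)\<^sup>2 - 3)"
      by (simp add: s2 algebra_simps)
    show ?thesis
      unfolding sin_add[of "3 * x"] sin_triple c3 sin_double cos_double_cos
      by (simp add: algebra_simps power2_eq_square)
  qed
  finally show ?thesis .
qed

text \<open>With \<open>v = (2 * cos x)^2\<close> the product is
  \<open>v * (v - 2)^3 / (v - 1)\<close>, and \<open>x \<le> pi / 12\<close> forces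
  \<open>v \<ge> 2 + sqrt 3 \<ge> 37/10\<close>.\<close>

lemma sin_quarters_bound:
  fixes x :: real
  assumes "0 < x" "x \<le> pi / 12"
  shows "sin (4 * x) / sin x * (sin (4 * x) / sin (2 * x)) * (sin (4 * x) / sin (3 * x)) \<ge> 6"
proof -
  define v where "v = (2 * cos x)\<^sup>2"
  have "cos (2 * x) \<ge> cos (pi / 6)"
    using assms by (intro cos_monotone_0_pi_le) auto
  moreover have "sqrt 3 \<ge> 17 / 10" by (rule real_le_rsqrt) (simp add: power2_eq_square)
  moreover have "v = 2 * cos (2 * x) + 2"
    by (simp add: v_def cos_double_cos power_mult_distrib)
  ultimately have v: "v \<ge> 37 / 10" "v \<le> 4" by (auto simp: cos_30)
  have s: "sin x > 0" "sin (2 * x) > 0" using assms by (auto intro!: sin_gt_zero)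
  have c: "cos x > 0" using assms by (intro cos_gt_zero) auto
  have e: "sin (2 * x) = sin x * (2 * cos x)" "sin (3 * x) = sin x * (v - 1)"
    "sin (4 * x) = sin x * (2 * cos x) * (v - 2)"
    using sin_double[of x] sin_triple[of x] sin_quadruple[of x] by (simp_all add: v_def)
  have "sin (4 * x) / sin x * (sin (4 * x) / sin (2 * x)) * (sin (4 * x) / sin (3 * x))
      = (2 * cos x * 2 * cos x) * (v - 2) ^ 3 / (v - 1)"
    unfolding e using s c v by (simp add: field_simps power3_eq_cube)
  also have "2 * cos x * 2 * cos x = v" by (simp add: v_def power2_eq_square)
  also have "v * (v - 2) ^ 3 / (v - 1) \<ge> 6"
  proof -
    \<comment> \<open>\<open>(17/10)^3 = 4.913\<close> exceeds 49/10, and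
      \<open>6 * (v - 1) \<le> 49/10 * v\<close> holds since \<open>v \<le> 4\<close>.\<close>
    have "(v - 2) ^ 3 \<ge> (17 / 10) ^ 3" using v by (intro power_mono) auto
    then have "v * (v - 2) ^ 3 \<ge> v * (49 / 10)"
      using v by (intro mult_left_mono) (auto simp: power3_eq_cube)
    moreover have "6 * (v - 1) \<le> v * (49 / 10)" using v by simp
    ultimately have "6 * (v - 1) \<le> v * (v - 2) ^ 3" by (rule order_trans[rotated])
    then show ?thesis using v by (simp add: pos_le_divide_eq)
  qed
  finally show ?thesis .
qed

text \<open>The factors are at least 1, and those for \<open>i = K/4, K/2, 3K/4\<close> suffice.\<close>

lemma sin_ratio_ge_6:
  assumes K: "4 dvd K" "K > 0" and l: "2 \<le> l" "l < d"
  shows "sin_ratio K d l \<ge> 6"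
proof -
  let ?s = "root_sin (K * d)"
  obtain r where r: "K = 4 * r" using K(1) by (elim dvdE)
  have "r > 0" using K r by simp
  have Kd: "K * 3 \<le> K * d" using l by (intro mult_left_mono) auto
  have pos: "?s i > 0" if "i \<in> {1..K}" for i
  proof (rule root_sin_pos)
    have "K < K * d" using K l by simp
    then show "i < K * d" using that by (meson atLeastAtMost_iff le_less_trans)
  qed (use that in auto)
  \<comment> \<open>The numerator indices lie between \<open>K\<close> and \<open>K * d - K\<close>,
    so each numerator is at least \<open>?s K\<close>.\<close>
  have "(\<Prod>i=1..K. ?s K / ?s i) \<le> sin_ratio K d l"
    unfolding sin_ratio_def
  proof (intro prod_mono conjI divide_right_mono)
    fix i assume i: "i \<in> {1..K}"
    have "K * l \<le> K * (d - 1)" using l by (intro mult_left_mono) auto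
    also have "\<dots> = K * d - K" by (simp add: diff_mult_distrib2)
    finally have "K * l \<le> K * d - K" .
    moreover have "K * (l - 1) + K = K * l" using l by (cases l) auto
    moreover have "K \<le> K * d" "i \<le> K" using Kd i by (linarith, simp)
    ultimately have "K * (l - 1) + i + K \<le> K * d" by linarith
    moreover have "K * 1 \<le> K * (l - 1)" using l by (intro mult_left_mono) auto
    then have "K \<le> K * (l - 1) + i" by linarith
    ultimately show "?s K \<le> ?s (K * (l - 1) + i)"
      using K Kd by (intro root_sin_le) auto
  qed (use pos[of K] pos K in \<open>auto intro!: divide_nonneg_pos less_imp_le\<close>)
  moreover have "(\<Prod>i\<in>{r, 2 * r, 3 * r}. ?s K / ?s i) \<le> (\<Prod>i=1..K. ?s K / ?s i)"
  proof (rule prod_mono2)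
    fix i assume i: "i \<in> {1..K} - {r, 2 * r, 3 * r}"
    have "i \<le> K" using i by simp
    then have "i + K \<le> K * d" using Kd by linarith
    then have "?s i \<le> ?s K" by (rule root_sin_le [rotated 2]) (use \<open>i \<le> K\<close> K l in auto)
    then show "1 \<le> ?s K / ?s i" using pos[of i] i by (simp add: le_divide_eq)
  next
    fix i assume "i \<in> {r, 2 * r, 3 * r}"
    then have "i \<in> {1..K}" using \<open>r > 0\<close> by (auto simp: r)
    then show "0 \<le> ?s K / ?s i" using pos[of i] pos[of K] K by simp
  qed (use \<open>r > 0\<close> in \<open>auto simp: r\<close>)
  moreover have "(\<Prod>i\<in>{r, 2 * r, 3 * r}. ?s K / ?s i) \<ge> 6"
  proof -
    define x where "x = pi / (4 * d)"
    have x: "0 < x" "x \<le> pi / 12" using l by (auto simp: x_def field_simps)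
    have s: "?s (j * r) = sin (j * x)" for j :: nat
      using \<open>r > 0\<close> by (simp add: root_sin_def x_def r) (simp add: mult.commute)
    have "(\<Prod>i\<in>{r, 2 * r, 3 * r}. ?s K / ?s i) = ?s K / ?s r * (?s K / ?s (2 * r)) * (?s K / ?s (3 * r))"
      using \<open>r > 0\<close> by simp
    also have "\<dots> = sin (4 * x) / sin x * (sin (4 * x) / sin (2 * x)) * (sin (4 * x) / sin (3 * x))"
      using s[of 1] s[of 2] s[of 3] s[of 4] by (simp add: r)
    finally show ?thesis using sin_quarters_bound[OF x] by simp
  qed
  ultimately show ?thesis by linarith
qed

text \<open>Consecutive products shrink by \<open>5/3 / 6 = 5/18\<close>, so the sum is at most
  \<open>18/13 - 1 = 5/13\<close>; the summand 1 at \<open>i = 0\<close> is added to start the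
  geometric series and then removed.\<close>

lemma tail_bound_uniform:
  fixes \<beta> :: "nat \<Rightarrow> real"
  assumes d: "d \<ge> 3" and \<beta>: "\<And>l. 2 \<le> l \<Longrightarrow> l < d \<Longrightarrow> \<beta> l \<ge> 6"
  shows "(\<Sum>i=1..<d - 1. (\<Prod>l=2..Suc i. 5 / 3 / \<beta> l)) \<le> 2 / 5"
proof -
  define T where "T i = (\<Prod>l=2..Suc i. 5 / 3 / \<beta> l)" for i
  have nonneg: "T i \<ge> 0" if "i < d - 1" for i
    unfolding T_def using that \<beta> by (intro prod_nonneg) (force intro!: divide_nonneg_nonneg)
  have "(\<Sum>i=0..d - 2. T i) \<le> T 0 / (1 - 5 / 18)"
  proof (rule sum_le_geometric)
    fix i assume i: "i < d - 2"
    then have b: "\<beta> (Suc (Suc i)) \<ge> 6" using \<beta> by simp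
    have "T (Suc i) = 5 / 3 / \<beta> (Suc (Suc i)) * T i" by (simp add: T_def prod.nat_ivl_Suc')
    also have "\<dots> \<le> 5 / 18 * T i"
      using b nonneg[of i] i by (intro mult_right_mono) (auto simp: field_simps)
    finally show "T (Suc i) \<le> 5 / 18 * T i" .
  qed (use d nonneg[of "d - 2"] in auto)
  moreover have "T 0 = 1" by (simp add: T_def)
  moreover have "(\<Sum>i=0..d - 2. T i) = T 0 + (\<Sum>i=1..<d - 1. T i)"
    using d by (subst sum.atLeast_Suc_atMost) (auto intro!: sum.cong)
  ultimately show ?thesis by (simp add: T_def)
qed

text \<open>For \<open>K = 2\<close> the ratios are small at both ends and large in between. The
  middle ones give a geometric sum with ratio 1/6; by then the products are so small that the last
  two need only be non-increasing.\<close>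

lemma tail_bound_peaked:
  fixes \<beta> :: "nat \<Rightarrow> real"
  assumes d: "d \<ge> 8" and \<beta>2: "\<beta> 2 \<ge> 26 / 5"
    and mid: "\<And>l. 3 \<le> l \<Longrightarrow> l \<le> d - 3 \<Longrightarrow> \<beta> l \<ge> 10"
    and last: "\<And>l. 2 \<le> l \<Longrightarrow> l < d \<Longrightarrow> \<beta> l > 5 / 3"
  shows "(\<Sum>i=1..<d - 1. (\<Prod>l=2..Suc i. 5 / 3 / \<beta> l)) \<le> 2 / 5"
proof -
  define T where "T i = (\<Prod>l=2..Suc i. 5 / 3 / \<beta> l)" for i
  have nonneg: "T i \<ge> 0" if "i < d - 1" for i
    unfolding T_def using that last by (intro prod_nonneg) (force intro!: divide_nonneg_nonneg)
  have T_Suc: "T (Suc i) = 5 / 3 / \<beta> (Suc (Suc i)) * T i" for i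
    by (simp add: T_def prod.nat_ivl_Suc')
  have T1: "T 1 \<le> 25 / 78"
    using \<beta>2 by (simp add: T_def numeral_2_eq_2 field_simps)
  have mid': "T (Suc i) \<le> 1 / 6 * T i" if "1 \<le> i" "i < d - 4" for i
  proof -
    have "\<beta> (Suc (Suc i)) \<ge> 10" using mid that by simp
    then show ?thesis
      unfolding T_Suc using nonneg[of i] that by (intro mult_right_mono) (auto simp: field_simps)
  qed
  have last': "T (Suc i) \<le> T i" if "i < d - 2" for i
  proof -
    have "\<beta> (Suc (Suc i)) > 5 / 3" using last that by simp
    then have "5 / 3 / \<beta> (Suc (Suc i)) * T i \<le> 1 * T i"
      using nonneg[of i] that by (intro mult_right_mono) (auto simp: field_simps)
    then show ?thesis by (simp add: T_Suc)
  qed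
  have "(\<Sum>i=1..d - 4. T i) \<le> T 1 / (1 - 1 / 6)"
    using mid' nonneg d by (intro sum_le_geometric) auto
  moreover have "T (d - 4) \<le> T 4"
    by (rule inc_induct[of 4 "d - 4" "\<lambda>i. T (d - 4) \<le> T i"])
      (use d last' in \<open>auto intro: order_trans\<close>)
  moreover have "T 2 \<le> T 1 / 6" "T 3 \<le> T 2 / 6" "T 4 \<le> T 3 / 6"
    using mid'[of 1] mid'[of 2] mid'[of 3] d by (simp_all add: eval_nat_numeral)
  moreover have "T (d - 3) \<le> T (d - 4)" "T (d - 2) \<le> T (d - 3)"
  proof -
    have "Suc (d - 4) = d - 3" "Suc (d - 3) = d - 2" using d by auto
    then show "T (d - 3) \<le> T (d - 4)" "T (d - 2) \<le> T (d - 3)"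
      using last'[of "d - 4"] last'[of "d - 3"] d by simp_all
  qed
  moreover have "(\<Sum>i=1..<d - 1. T i) = (\<Sum>i=1..d - 4. T i) + T (d - 3) + T (d - 2)"
  proof -
    have "{1..<d - 1} = insert (d - 2) (insert (d - 3) {1..d - 4})" using d by auto
    moreover have "d - 2 \<notin> insert (d - 3) {1..d - 4}" "d - 3 \<notin> {1..d - 4}" using d by auto
    ultimately show ?thesis by simp
  qed
  \<comment> \<open>The sum is at most \<open>(6/5 + 2/216) * T 1\<close> with
    \<open>T 1 \<le> 25/78\<close>; \<open>d \<ge> 8\<close> makes
    \<open>T (d - 4) \<le> T 4 \<le> T 1 / 216\<close> available.\<close>
  ultimately have "(\<Sum>i=1..<d - 1. T i) \<le> 2 / 5" using T1 by simp
  then show ?thesis by (simp add: T_def)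
qed

lemma sin_ratio_2:
  "sin_ratio 2 d l = root_sin (2 * d) (2 * (l - 1) + 1) * root_sin (2 * d) (2 * (l - 1) + 2)
    / (root_sin (2 * d) 1 * root_sin (2 * d) 2)"
  by (simp add: sin_ratio_def numeral_2_eq_2)

text \<open>The multiple-angle formulas make the quotients polynomials in
  \<open>y = 2 * cos (2 * x)\<close>, and \<open>d \<ge> 8\<close> gives
  \<open>y \<ge> 2 * cos (pi / 8) \<ge> 46/25\<close>.\<close>

lemma sin_ratio_2_bounds:
  assumes d: "d \<ge> 8"
  shows "sin_ratio 2 d 2 \<ge> 26 / 5"
    and "\<And>l. 3 \<le> l \<Longrightarrow> l \<le> d - 3 \<Longrightarrow> sin_ratio 2 d l \<ge> 10"
    and "\<And>l. 2 \<le> l \<Longrightarrow> l < d \<Longrightarrow> sin_ratio 2 d l > 5 / 3"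
proof -
  define x where "x = pi / (2 * d)"
  define y where "y = 2 * cos (2 * x)"
  let ?s = "root_sin (2 * d)"
  have s: "?s j = sin (j * x)" for j
    by (simp add: root_sin_def x_def mult_ac)
  have x: "0 < x" "2 * x \<le> pi / 8" using d by (auto simp: x_def field_simps)
  have pos: "?s 1 > 0" "?s 2 > 0" using d by (auto intro!: root_sin_pos)
  have cosx: "4 * (cos x)\<^sup>2 = y + 2" by (simp add: y_def cos_double_cos)
  have e: "?s 3 = ?s 1 * (y + 1)" "?s 4 = ?s 2 * y" "?s 5 = ?s 1 * (y\<^sup>2 + y - 1)" "?s 6 = ?s 2 * (y\<^sup>2 - 1)"
    using sin_triple[of x] sin_quadruple[of x] sin_quintuple[of x] sin_triple[of "2 * x"]
    by (simp_all add: s cosx flip: y_def)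
  have "cos (pi / 4) = 2 * (cos (pi / 8))\<^sup>2 - 1" using cos_double_cos[of "pi / 8"] by simp
  moreover have "sqrt 2 \<ge> 7 / 5" by (rule real_le_rsqrt) (simp add: power2_eq_square)
  ultimately have "(23 / 25)\<^sup>2 \<le> (cos (pi / 8))\<^sup>2" by (simp add: cos_45 power2_eq_square)
  then have "23 / 25 \<le> cos (pi / 8)" by (rule power2_le_imp_le) (auto intro!: cos_ge_zero)
  also have "\<dots> \<le> cos (2 * x)" using x by (intro cos_monotone_0_pi_le) auto
  finally have y: "y \<ge> 46 / 25" by (simp add: y_def)
  then have y2: "y\<^sup>2 \<ge> (46 / 25)\<^sup>2" by (intro power_mono) auto
  have "y * (y + 1) \<ge> 46 / 25 * (46 / 25 + 1)" using y by (intro mult_mono) auto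
  moreover have "sin_ratio 2 d 2 = ?s 3 * ?s 4 / (?s 1 * ?s 2)"
  proof -
    have "2 * (2 - 1) + 1 = (3 :: nat)" "2 * (2 - 1) + 2 = (4 :: nat)" by simp_all
    then show ?thesis unfolding sin_ratio_2 by (simp only:)
  qed
  then have "sin_ratio 2 d 2 = y * (y + 1)" using pos by (simp add: e)
  ultimately show "sin_ratio 2 d 2 \<ge> 26 / 5" by simp
  show "sin_ratio 2 d l \<ge> 10" if l: "3 \<le> l" "l \<le> d - 3" for l
  proof -
    have "(46 / 25)\<^sup>2 + 46 / 25 - 1 \<le> y\<^sup>2 + y - 1" "(46 / 25)\<^sup>2 - 1 \<le> y\<^sup>2 - 1"
      using y y2 by linarith+
    then have "((46 / 25)\<^sup>2 + 46 / 25 - 1) * ((46 / 25)\<^sup>2 - 1) \<le> (y\<^sup>2 + y - 1) * (y\<^sup>2 - 1)"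
      by (rule mult_mono) (use y zero_le_power2[of y] in \<open>linarith, simp add: power2_eq_square\<close>)
    then have "10 * (?s 1 * ?s 2) \<le> (y\<^sup>2 + y - 1) * (y\<^sup>2 - 1) * (?s 1 * ?s 2)"
      using pos by (intro mult_right_mono) (auto simp: power2_eq_square)
    also have "\<dots> = ?s 5 * ?s 6" by (simp add: e)
    \<comment> \<open>The indices \<open>2*l - 1\<close> and \<open>2*l\<close> lie in
      \<open>[5, 2*d - 5]\<close> and \<open>[6, 2*d - 6]\<close>, where the sine is smallest at the
      ends.\<close>
    also have "\<dots> \<le> ?s (2 * (l - 1) + 1) * ?s (2 * (l - 1) + 2)"
      using l d by (intro mult_mono root_sin_le less_imp_le[OF root_sin_pos]) auto
    finally show ?thesis using pos by (simp add: sin_ratio_2 field_simps)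
  qed
  show "sin_ratio 2 d l > 5 / 3" if l: "2 \<le> l" "l < d" for l
  proof -
    have "5 / 3 * (?s 1 * ?s 2) < (y + 1) * (?s 1 * ?s 2)"
      using pos y by (intro mult_strict_right_mono) auto
    also have "\<dots> = ?s 3 * ?s 2" by (simp add: e)
    also have "\<dots> \<le> ?s (2 * (l - 1) + 1) * ?s (2 * (l - 1) + 2)"
      using l d by (intro mult_mono root_sin_le less_imp_le[OF root_sin_pos]) auto
    finally show ?thesis using pos by (simp add: sin_ratio_2 field_simps)
  qed
qed

lemma norm_euler_at_less:
  fixes k d :: nat
  defines "z \<equiv> cis (2 * pi / real (2 ^ k * d))"
  assumes k: "k \<ge> 1" and d: "d \<ge> 3" "k \<ge> 2 \<or> d \<ge> 8" and b: "2 \<le> b" "b < d" "b' < b"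
  shows "norm (euler_at (2 ^ k) z b') < norm (euler_at (2 ^ k) z b)"
proof -
  let ?E = "euler_at (2 ^ k) z"
  have "(\<forall>l. 2 \<le> l \<and> l < d \<longrightarrow> sin_ratio (2 ^ k) d l > 5 / 3) \<and>
      (\<Sum>i=1..<d - 1. (\<Prod>l=2..Suc i. 5 / 3 / sin_ratio (2 ^ k) d l)) \<le> 2 / 5"
  proof (cases "k \<ge> 2")
    case True
    then have "(2 :: nat) ^ 2 dvd 2 ^ k" by (rule le_imp_power_dvd)
    then have "sin_ratio (2 ^ k) d l \<ge> 6" if "2 \<le> l" "l < d" for l
      using that by (intro sin_ratio_ge_6) auto
    then show ?thesis using tail_bound_uniform[OF d(1)] by force
  next
    case False
    then have "k = 1" "d \<ge> 8" using k d(2) by auto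
    then show ?thesis
      using sin_ratio_2_bounds[of d] tail_bound_peaked[of d "sin_ratio 2 d"]
      by (simp only: power_one_right) blast
  qed
  then have bounds: "\<And>l. 2 \<le> l \<Longrightarrow> l < d \<Longrightarrow> sin_ratio (2 ^ k) d l > 5 / 3"
    and tail: "(\<Sum>i=1..<d - 1. (\<Prod>l=2..Suc i. 5 / 3 / sin_ratio (2 ^ k) d l)) \<le> 2 / 5"
    by blast+
  have step: "norm (?E m) < norm (?E (Suc m))" if "1 \<le> m" "Suc m < d" "?E m \<noteq> 0" for m
    unfolding z_def using that by (intro growth_criterion bounds tail d) (auto simp: z_def)
  have E1: "norm (?E 1) = 1" "norm (?E 0) = 1" by (simp_all add: euler_at_1)
  \<comment> \<open>The bound by 1 is carried along because \<open>step\<close> needs a nonzero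
    value. The growth starts only at \<open>b = 2\<close>, since the values at 0 and 1 both have
    norm 1.\<close>
  have "norm (?E b) > 1 \<and> norm (?E b') < norm (?E b)" using b
  proof (induction b arbitrary: b' rule: nat_induct_at_least)
    case base
    have "norm (?E 1) < norm (?E 2)" using step[of 1] base by (simp add: euler_at_1 numeral_2_eq_2)
    moreover have "b' = 0 \<or> b' = 1" using base by auto
    ultimately show ?case using E1 by auto
  next
    case (Suc b)
    have "norm (?E b) > 1" using Suc.IH[of 0] Suc by simp
    then have "norm (?E b) < norm (?E (Suc b))" using step[of b] Suc by fastforce
    moreover have "norm (?E b') \<le> norm (?E b)"
      using Suc.IH[of b'] Suc.prems by (cases "b' = b") auto
    ultimately show ?case using \<open>norm (?E b) > 1\<close> by linarith
  qed
  then show ?thesis by simp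
qed

subsection \<open>The non-congruence\<close>

lemma of_int_eval_at: "of_int (eval_at z p) = eval_at (of_int z) p"
  by (induction p) (simp_all add: eval_at_pCons)

text \<open>For \<open>K = 2\<close> and \<open>d \<le> 7\<close> the growth estimates are too weak, and the polynomials are evaluated at
  \<open>q = 3\<close> instead; at \<open>q = 2\<close> the case \<open>d = 3\<close> would fail.\<close>

lemma euler_at_2_3:
  "euler_at 2 (3 :: int) 2 = 129"
  "euler_at 2 (3 :: int) 3 = -1409409"
  "euler_at 2 (3 :: int) 4 = 1253405000961"
  "euler_at 2 (3 :: int) 5 = -90337117144458694401"
  "euler_at 2 (3 :: int) 6 = 527414664652491714233203795329"
proof -
  \<comment> \<open>The recurrence \<open>euler_at_rec\<close> needs a field, so the values are
    computed over the reals and carried back to the integers by \<open>R\<close>.\<close>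
  let ?E = "euler_at 2 (3 :: real)"
  have P: "qpoch 3 3 (numeral v) = qpoch 3 3 (pred_numeral v) * (1 - 3 * 3 ^ pred_numeral v :: real)" for v
    by (simp add: numeral_eq_Suc qpoch_Suc)
  have "(3 :: real) ^ j \<noteq> 1" if "j > 0" for j
  proof -
    have "(1 :: real) < 3 ^ j" using that by simp
    then show ?thesis by (rule less_imp_neq [symmetric])
  qed
  then have nz: "qpoch (3 :: real) 3 j \<noteq> 0" for j
    unfolding qpoch_eq_0_iff by blast
  have rec: "(\<Sum>n\<le>m. ?E n / (qpoch 3 3 (2 * n) * qpoch 3 3 (2 * (m - n)))) = (if m = 0 then 1 else 0)" for m
    by (rule euler_at_rec) (use nz in auto)
  have 0: "?E 0 = 1" "?E (Suc 0) = -1" by (simp_all add: euler_at_1)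
  have 2: "?E 2 = 129"
    using rec[of 2] by (simp add: atMost_nat_numeral P qpoch_Suc 0)
  have 3: "?E 3 = -1409409"
    using rec[of 3] by (simp add: atMost_nat_numeral P qpoch_Suc 0 2)
  have 4: "?E 4 = 1253405000961"
    using rec[of 4] by (simp add: atMost_nat_numeral P qpoch_Suc 0 2 3)
  have 5: "?E 5 = -90337117144458694401"
    using rec[of 5] by (simp add: atMost_nat_numeral P qpoch_Suc 0 2 3 4)
  have 6: "?E 6 = 527414664652491714233203795329"
    using rec[of 6] by (simp add: atMost_nat_numeral P qpoch_Suc 0 2 3 4 5)
  have R: "real_of_int (euler_at 2 3 m) = ?E m" for m
    by (simp add: euler_at_def of_int_eval_at)
  from R[of 2] show "euler_at 2 (3 :: int) 2 = 129" unfolding 2 by linarith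
  from R[of 3] show "euler_at 2 (3 :: int) 3 = -1409409" unfolding 3 by linarith
  from R[of 4] show "euler_at 2 (3 :: int) 4 = 1253405000961" unfolding 4 by linarith
  from R[of 5] show "euler_at 2 (3 :: int) 5 = -90337117144458694401" unfolding 5 by linarith
  from R[of 6] show "euler_at 2 (3 :: int) 6 = 527414664652491714233203795329" unfolding 6 by linarith
qed

lemma euler_at_2_3_not_dvd:
  assumes "3 \<le> d" "d \<le> 7" "b' < b" "b < d"
  shows "\<not> (1 + 3 ^ d :: int) dvd euler_at 2 3 b - 3 ^ (b - b') * euler_at 2 3 b'"
proof -
  have "d = 3 \<or> d = 4 \<or> d = 5 \<or> d = 6 \<or> d = 7" using assms by linarith
  moreover have "b = 1 \<or> b = 2 \<or> b = 3 \<or> b = 4 \<or> b = 5 \<or> b = 6" using assms by linarith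
  moreover have "b' = 0 \<or> b' = 1 \<or> b' = 2 \<or> b' = 3 \<or> b' = 4 \<or> b' = 5" using assms by linarith
  ultimately show ?thesis
    using assms(3,4) by (elim disjE) (simp_all add: euler_at_2_3 euler_at_1)
qed

lemma dvd_iff_euler_at:
  assumes "n \<le> m" "H * d > 0"
  shows "(1 + monom 1 (H * d) :: int poly) dvd
      (q_euler K (K * m) - monom 1 (H * (m - n)) * q_euler K (K * n))
    \<longleftrightarrow> (\<forall>z::complex. z ^ (H * d) = -1 \<longrightarrow> euler_at K z m = z ^ (H * (m - n)) * euler_at K z n)"
  unfolding dvd_iff_eval_at_roots[OF assms(2)] by (simp add: euler_at_def)

lemma euler_not_congruent:
  assumes k: "k \<ge> 1" and b: "b' < b" "b < d"
  shows "\<not> (1 + monom 1 (2 ^ (k - 1) * d) :: int poly) dvd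
           (q_euler (2 ^ k) (2 ^ k * b) - monom 1 (2 ^ (k - 1) * (b - b')) * q_euler (2 ^ k) (2 ^ k * b'))"
    (is "\<not> ?dvd")
proof
  assume dvd: ?dvd
  define H :: nat where "H = 2 ^ (k - 1)"
  have K: "2 ^ k = 2 * H" using k by (simp add: H_def flip: power_Suc)
  have "H > 0" "d > 0" using b by (auto simp: H_def)
  define z where "z = cis (2 * pi / real (2 ^ k * d))"
  have z_power: "z ^ j = cis (pi * j / (H * d))" for j
    by (simp add: z_def Complex.DeMoivre K[THEN arg_cong[of _ _ real], simplified] mult_ac)
  have "z ^ (H * d) = -1" using \<open>H > 0\<close> \<open>d > 0\<close> by (simp add: z_power)
  then have eq: "euler_at (2 ^ k) z b = z ^ (H * (b - b')) * euler_at (2 ^ k) z b'"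
    using dvd dvd_iff_euler_at[of b' b "2 ^ (k - 1)" d] b by (simp add: H_def)
  have norm_eq: "norm (euler_at (2 ^ k) z b) = norm (euler_at (2 ^ k) z b')"
    unfolding eq norm_mult norm_power by (simp add: z_def)
  show False
  proof (cases "b = 1")
    case True
    then have "b' = 0" using b by simp
    \<comment> \<open>Here both norms are 1, so the arguments must decide:
      \<open>z^H = cis (pi / d)\<close> with \<open>d > 1\<close>.\<close>
    then have "z ^ H = -1" using eq True by (simp add: euler_at_1)
    then have "cos (pi / d) = -1"
      using \<open>H > 0\<close> by (simp add: z_power complex_eq_iff)
    moreover have "cos (pi / d) > cos pi"
      using b True by (intro cos_monotone_0_pi) (auto simp: field_simps)
    ultimately show False by simp
  next
    case False
    then have "2 \<le> b" "d \<ge> 3" using b by auto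
    show False
    proof (cases "k \<ge> 2 \<or> d \<ge> 8")
      case True
      then show False
        using norm_euler_at_less[OF k \<open>d \<ge> 3\<close> True \<open>2 \<le> b\<close> b(2,1)] norm_eq by (simp add: z_def)
    next
      case False
      then have "k = 1" "d \<le> 7" using k by auto
      \<comment> \<open>Divisibility of integer polynomials passes to their values at an
        integer.\<close>
      from dvd have "eval_at (3 :: int) (1 + monom 1 d) dvd
          eval_at 3 (q_euler 2 (2 * b) - monom 1 (b - b') * q_euler 2 (2 * b'))"
        unfolding \<open>k = 1\<close> by (elim dvdE) simp
      then show False
        using euler_at_2_3_not_dvd[OF \<open>d \<ge> 3\<close> \<open>d \<le> 7\<close> b] by (simp add: euler_at_def)
    qed
  qed
qed

theorem theorem5p2:
  fixes k m n d :: nat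
  assumes "k \<ge> 1" and "m > n" and "1 \<le> d" and "d \<le> m"
  shows "(1 + monom 1 (2 ^ (k - 1) * d) :: int poly) dvd
           (q_euler (2 ^ k) (2 ^ k * m)
             - monom 1 (2 ^ (k - 1) * (m - n)) * q_euler (2 ^ k) (2 ^ k * n))
         \<longleftrightarrow> [m = n] (mod d)"
proof -
  define H :: nat where "H = 2 ^ (k - 1)"
  have "H > 0" "d > 0" using assms by (auto simp: H_def)
  let ?E = "euler_at (2 ^ k) :: complex \<Rightarrow> nat \<Rightarrow> complex"
  have per: "?E z (i + d * j) = z ^ (H * (d * j)) * ?E z i" if "z ^ (H * d) = -1" for z i j
    using euler_at_periodic[OF assms(1) \<open>d > 0\<close>, of z i j] that by (simp add: H_def)
  \<comment> \<open>The symmetric form without \<open>i - j\<close> also serves the residues, of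
    which either may be the larger.\<close>
  have iff: "(1 + monom 1 (H * d) :: int poly) dvd
      (q_euler (2 ^ k) (2 ^ k * i) - monom 1 (H * (i - j)) * q_euler (2 ^ k) (2 ^ k * j))
    \<longleftrightarrow> (\<forall>z::complex. z ^ (H * d) = -1 \<longrightarrow> z ^ (H * j) * ?E z i = z ^ (H * i) * ?E z j)"
    if "j \<le> i" for i j
  proof -
    have "z ^ (H * j) * ?E z i = z ^ (H * i) * ?E z j \<longleftrightarrow> ?E z i = z ^ (H * (i - j)) * ?E z j"
      if "z ^ (H * d) = -1" for z
    proof -
      have "z \<noteq> 0" using that \<open>H > 0\<close> \<open>d > 0\<close> by (auto simp: power_0_left)
      moreover have "z ^ (H * i) = z ^ (H * j) * z ^ (H * (i - j))"
        using \<open>j \<le> i\<close> by (simp flip: power_add distrib_left)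
      ultimately show ?thesis by simp
    qed
    then show ?thesis
      using dvd_iff_euler_at[OF that, of H d] \<open>H > 0\<close> \<open>d > 0\<close> by auto
  qed
  define b c where "b = m mod d" and "c = n mod d"
  have b: "m = b + d * (m div d)" "b < d" and c: "n = c + d * (n div d)" "c < d"
    using \<open>d > 0\<close> by (simp_all add: b_def c_def)
  have reduce: "z ^ (H * n) * ?E z m = z ^ (H * m) * ?E z n \<longleftrightarrow> z ^ (H * c) * ?E z b = z ^ (H * b) * ?E z c"
    if "z ^ (H * d) = -1" for z
  proof -
    \<comment> \<open>Both sides acquire this same nonzero factor when \<open>m\<close> and
      \<open>n\<close> are replaced by their residues.\<close>
    define w where "w = z ^ (H * (d * (m div d))) * z ^ (H * (d * (n div d)))"
    have "w \<noteq> 0" using that \<open>H > 0\<close> \<open>d > 0\<close> by (auto simp: w_def power_0_left)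
    have "z ^ (H * n) * ?E z m = w * (z ^ (H * c) * ?E z b)"
      using per[OF that, of b "m div d"] b(1) arg_cong[OF c(1), of "\<lambda>j. z ^ (H * j)"]
      by (simp add: w_def distrib_left power_add)
    moreover have "z ^ (H * m) * ?E z n = w * (z ^ (H * b) * ?E z c)"
      using per[OF that, of c "n div d"] c(1) arg_cong[OF b(1), of "\<lambda>j. z ^ (H * j)"]
      by (simp add: w_def distrib_left power_add)
    ultimately show ?thesis using \<open>w \<noteq> 0\<close> by simp
  qed
  have "(\<forall>z::complex. z ^ (H * d) = -1 \<longrightarrow> z ^ (H * c) * ?E z b = z ^ (H * b) * ?E z c) \<longleftrightarrow> b = c"
    (is "?R \<longleftrightarrow> _")
  proof
    assume R: ?R
    show "b = c"
    proof (rule linorder_cases)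
      assume "c < b"
      then have False
        using euler_not_congruent[OF assms(1) \<open>c < b\<close> b(2), folded H_def] iff[of c b] R by simp
      then show ?thesis ..
    next
      assume "b < c"
      then have False
        using euler_not_congruent[OF assms(1) \<open>b < c\<close> c(2), folded H_def] iff[of b c] R by simp
      then show ?thesis ..
    qed (rule sym)
  qed simp
  then have "(1 + monom 1 (H * d) :: int poly) dvd
      (q_euler (2 ^ k) (2 ^ k * m) - monom 1 (H * (m - n)) * q_euler (2 ^ k) (2 ^ k * n)) \<longleftrightarrow> b = c"
    using iff[of n m] reduce assms(2) by simp
  then show ?thesis by (simp add: H_def b_def c_def cong_def)
qed

end
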